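(* Let $\beta\in[0,1]$ and $f\in\mathcal{A}$. Then $f\in\mathcal{A}_\beta$ if and only if $$ f(z) * z\left(\frac{1-\beta z}{(1-z)^2}-\frac{1+\zeta}{1-\zeta}\right)\neq 0 $$ for all $z\in\mathbb{D}\setminus\{0\}$ and all $\zeta\in\mathbb{C}$ with $|\zeta|=1$, $\zeta\neq 1$.
   Context: $\mathbb{D}=\{z\in\mathbb{C}:|z|<1\}$. $\mathcal{A}$ is the class of functions $f$ holomorphic in $\mathbb{D}$ with $f(0)=0$ and $f'(0)=1$. For $\beta\in[0,1]$, $$\mathcal{A}_\beta=\left\{f\in\mathcal{A}:\operatorname{Re}\left(\beta\frac{f(z)}{z}+(1-\beta)f'(z)\right)>0 \text{ for all } z\in\mathbb{D}\right\},$$ where $f(z)/z$ is given the value $1$ at $z=0$. The Hadamard product (convolution) of $f(z)=\sum_{n\ge0}a_nz^n$ and $g(z)=\sum_{n\ge0}b_nz^n$ is $(f*g)(z)=\sum_{n\ge0}a_nb_nz^n$. In the displayed condition, the function convolved with $f$ is $z\mapsto z\left(\frac{1-\beta z}{(1-z)^2}-\frac{1+\zeta}{1-\zeta}\right)$. *)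

theory Defs
  imports "HOL-Complex_Analysis.Complex_Analysis"
begin

definition unit_disc :: "complex set" where
  "unit_disc = ball 0 1"

definition class_A :: "(complex \<Rightarrow> complex) set" where
  "class_A = {f. f holomorphic_on unit_disc \<and> f 0 = 0 \<and> deriv f 0 = 1}"

text \<open>The case distinction is the removable singularity of \<open>f z / z\<close> at \<open>0\<close>, where the
  limit is \<open>f' 0 = 1\<close> (HOL's division would give \<open>0\<close> there).\<close>

definition class_A_beta :: "real \<Rightarrow> (complex \<Rightarrow> complex) set" where
  "class_A_beta \<beta> = {f \<in> class_A. \<forall>z\<in>unit_disc.
     Re (of_real \<beta> * (if z = 0 then 1 else f z / z) + of_real (1 - \<beta>) * deriv f z) > 0}"

text \<open>Coefficients are the Taylor coefficients at \<open>0\<close>. The definition is meaningful where the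
  series converges, in particular on the unit disc if \<open>f\<close> and \<open>g\<close> are holomorphic there.\<close>

definition hadamard_prod ::
  "(complex \<Rightarrow> complex) \<Rightarrow> (complex \<Rightarrow> complex) \<Rightarrow> complex \<Rightarrow> complex" where
  "hadamard_prod f g z =
     (\<Sum>n. fps_nth (fps_expansion f 0) n * fps_nth (fps_expansion g 0) n * z ^ n)"

end

theory Submission
  imports Defs
begin

text \<open>
  Write \<open>p z = \<beta> f z / z + (1 - \<beta>) f' z\<close>, with \<open>p 0 = 1\<close>. The Taylor coefficients of
  \<open>w (1 - \<beta> w) / (1 - w)\<^sup>2\<close> are \<open>\<beta> + n (1 - \<beta>)\<close> for \<open>n \<ge> 1\<close>, so convolution with this
  function is the differential operator \<open>f \<mapsto> \<beta> f + (1 - \<beta>) z f'\<close>, while convolution with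
  \<open>c w\<close> picks out \<open>c z\<close> from a normalised \<open>f\<close>. Hence the Hadamard product in question
  equals \<open>z (p z - c)\<close> with \<open>c = (1 + \<zeta>) / (1 - \<zeta>)\<close> (lemma \<open>hadamard_prod_kernel\<close>).

  The Cayley transform \<open>\<zeta> \<mapsto> (1 + \<zeta>) / (1 - \<zeta>)\<close> carries the unit circle without \<open>1\<close> onto the
  whole imaginary axis (lemma \<open>Cayley_transform_unit_circle\<close>). The nonvanishing condition
  therefore says precisely that \<open>p\<close> omits the imaginary axis, that is, that the continuous
  function \<open>Re p\<close> has no zero on the disc. As the disc is connected and \<open>Re (p 0) = 1\<close>, this is
  the same as \<open>Re p > 0\<close>.
\<close>

lemma fps_expansion_kernel_nth:
  fixes b c :: complex
  shows "fps_nth (fps_expansion (\<lambda>w. w * ((1 - b * w) / (1 - w)\<^sup>2 - c)) 0) n =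
    (if n = 0 then 0 else b + of_nat n * (1 - b) - (if n = 1 then c else 0))"
proof -
  define G :: "complex fps" where "G = Abs_fps (\<lambda>n. 1 + of_nat n * (1 - b))"
  \<comment> \<open>Multiplying by \<open>1 - X\<close> takes differences of consecutive coefficients, and those of \<open>G\<close>
    are affine in the index, so two such multiplications leave a polynomial.\<close>
  have "G * (1 - fps_X) = Abs_fps (\<lambda>n. if n = 0 then 1 else 1 - b)"
    by (rule fps_ext) (auto simp: G_def algebra_simps Suc_le_eq)
  also have "\<dots> * (1 - fps_X) = 1 - fps_const b * fps_X"
    by (rule fps_ext) (auto simp: algebra_simps)
  finally have G: "G * (1 - fps_X)\<^sup>2 = 1 - fps_const b * fps_X"
    by (simp add: power2_eq_square mult.assoc)
  have "(\<lambda>w. w * ((1 - b * w) / (1 - w)\<^sup>2 - c)) has_fps_expansion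
          fps_X * ((1 - fps_const b * fps_X) / (1 - fps_X)\<^sup>2 - fps_const c)"
    by (intro fps_expansion_intros) auto
  moreover have "(1 - fps_const b * fps_X) / (1 - fps_X)\<^sup>2 = G"
  proof -
    have "fps_nth ((1 - fps_X :: complex fps)\<^sup>2) 0 \<noteq> 0"
      by simp
    hence "(1 - fps_X :: complex fps)\<^sup>2 \<noteq> 0"
      by fastforce
    thus ?thesis
      unfolding G [symmetric] by (rule nonzero_mult_div_cancel_right)
  qed
  ultimately have eq: "fps_expansion (\<lambda>w. w * ((1 - b * w) / (1 - w)\<^sup>2 - c)) 0 = fps_X * (G - fps_const c)"
    by (simp add: fps_expansion_eqI)
  show ?thesis
    unfolding eq by (auto simp: G_def algebra_simps Suc_le_eq)
qed

lemma sums_deriv_fps_expansion: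
  assumes "f holomorphic_on ball 0 r" and "z \<in> ball 0 r"
  shows "(\<lambda>n. of_nat n * fps_nth (fps_expansion f 0) n * z ^ n) sums (z * deriv f z)"
proof -
  have "(\<lambda>n. (deriv ^^ n) (deriv f) 0 / fact n * (z - 0) ^ n) sums deriv f z"
    using assms by (intro holomorphic_power_series holomorphic_deriv) auto
  hence "(\<lambda>n. z * ((deriv ^^ Suc n) f 0 / fact n * z ^ n)) sums (z * deriv f z)"
    by (intro sums_mult) (simp add: funpow_Suc_right del: funpow.simps)
  also have "(\<lambda>n. z * ((deriv ^^ Suc n) f 0 / fact n * z ^ n)) =
      (\<lambda>n. of_nat (Suc n) * fps_nth (fps_expansion f 0) (Suc n) * z ^ Suc n)"
    by (auto simp: fps_expansion_def divide_simps simp del: funpow.simps of_nat_Suc)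
  finally show ?thesis
    by (subst (asm) sums_Suc_iff) simp
qed

text \<open>Multiplying \<open>a\<^sub>n z\<^sup>n\<close> by \<open>b + n (1 - b)\<close> is applying \<open>b + (1 - b) z d/dz\<close> to it. At \<open>n = 0\<close> the
  kernel's coefficient is \<open>0\<close> rather than \<open>b\<close>; the two agree on \<open>f\<close> because \<open>f 0 = 0\<close>.\<close>

lemma hadamard_prod_kernel:
  assumes "f \<in> class_A" and "z \<in> unit_disc"
  shows "hadamard_prod f (\<lambda>w. w * ((1 - b * w) / (1 - w)\<^sup>2 - c)) z =
    b * f z + (1 - b) * (z * deriv f z) - c * z"
proof -
  let ?a = "fps_nth (fps_expansion f 0)"
  have f: "f holomorphic_on ball 0 1" "f 0 = 0" "deriv f 0 = 1" and z: "z \<in> ball 0 1"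
    using assms by (auto simp: class_A_def unit_disc_def)
  have a: "?a 0 = 0" "?a (Suc 0) = 1"
    using f by (auto simp: fps_expansion_def)
  have "(\<lambda>n. ?a n * z ^ n) sums f z"
    using holomorphic_power_series [OF f(1) z] by (simp add: fps_expansion_def)
  hence "(\<lambda>n. b * (?a n * z ^ n) + (1 - b) * (of_nat n * ?a n * z ^ n)
            - (if n = 1 then c * z ^ n else 0))
      sums (b * f z + (1 - b) * (z * deriv f z) - c * z ^ 1)"
    by (intro sums_diff sums_add sums_mult sums_deriv_fps_expansion [OF f(1) z] sums_single)
  also have "(\<lambda>n. b * (?a n * z ^ n) + (1 - b) * (of_nat n * ?a n * z ^ n)
            - (if n = 1 then c * z ^ n else 0)) =
      (\<lambda>n. ?a n * fps_nth (fps_expansion (\<lambda>w. w * ((1 - b * w) / (1 - w)\<^sup>2 - c)) 0) n * z ^ n)"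
    unfolding fps_expansion_kernel_nth by (rule ext) (auto simp: a algebra_simps)
  finally show ?thesis
    by (simp add: hadamard_prod_def sums_iff)
qed

lemma Cayley_transform_unit_circle:
  "(\<lambda>\<zeta>. (1 + \<zeta>) / (1 - \<zeta>)) ` {\<zeta>::complex. norm \<zeta> = 1 \<and> \<zeta> \<noteq> 1} = {c. Re c = 0}"
proof (intro equalityI subsetI)
  fix c :: complex
  assume "c \<in> (\<lambda>\<zeta>. (1 + \<zeta>) / (1 - \<zeta>)) ` {\<zeta>. norm \<zeta> = 1 \<and> \<zeta> \<noteq> 1}"
  then obtain \<zeta> where \<zeta>: "norm \<zeta> = 1" and c: "c = (1 + \<zeta>) / (1 - \<zeta>)"
    by auto
  have "(Re \<zeta>)\<^sup>2 + (Im \<zeta>)\<^sup>2 = 1"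
    using \<zeta> by (simp flip: cmod_power2)
  hence "Re (1 + \<zeta>) * Re (1 - \<zeta>) + Im (1 + \<zeta>) * Im (1 - \<zeta>) = 0"
    by (simp add: algebra_simps power2_eq_square)
  thus "c \<in> {c. Re c = 0}"
    unfolding c by (simp only: Re_divide mem_Collect_eq div_0)
next
  fix c :: complex
  assume "c \<in> {c. Re c = 0}"
  hence c: "Re c = 0"
    by simp
  hence ne: "c + 1 \<noteq> 0"
    by (auto simp: complex_eq_iff)
  \<comment> \<open>The inverse of the Cayley transform.\<close>
  define \<zeta> where "\<zeta> = (c - 1) / (c + 1)"
  have "norm (c - 1) = norm (c + 1)"
    using c by (simp add: cmod_def)
  hence "norm \<zeta> = 1"
    using ne by (simp add: \<zeta>_def norm_divide)
  moreover have "\<zeta> \<noteq> 1"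
    using ne by (simp add: \<zeta>_def divide_simps)
  moreover have "c = (1 + \<zeta>) / (1 - \<zeta>)"
    using ne by (simp add: \<zeta>_def divide_simps)
  ultimately show "c \<in> (\<lambda>\<zeta>. (1 + \<zeta>) / (1 - \<zeta>)) ` {\<zeta>. norm \<zeta> = 1 \<and> \<zeta> \<noteq> 1}"
    by blast
qed

lemma continuous_on_quotient_removed_singularity:
  assumes "f \<in> class_A"
  shows "continuous_on unit_disc (\<lambda>z. if z = 0 then 1 else f z / z)"
proof -
  have f: "f holomorphic_on ball 0 1" "f 0 = 0" "deriv f 0 = 1"
    using assms by (auto simp: class_A_def unit_disc_def)
  have "(\<lambda>z. if z = 0 then deriv f 0 else (f z - f 0) / (z - 0)) holomorphic_on ball 0 1"
    by (rule pole_lemma_open) (use f in auto)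
  thus ?thesis
    using f by (auto simp: unit_disc_def intro: holomorphic_on_imp_continuous_on cong: if_cong)
qed

lemma connected_continuous_positive_iff_nonzero:
  fixes u :: "'a::topological_space \<Rightarrow> real"
  assumes "connected S" and "continuous_on S u" and "a \<in> S" and "u a > 0"
  shows "(\<forall>x\<in>S. u x > 0) \<longleftrightarrow> (\<forall>x\<in>S. u x \<noteq> 0)"
proof safe
  fix x assume nz: "\<forall>x\<in>S. u x \<noteq> 0" and x: "x \<in> S"
  show "u x > 0"
  proof (rule ccontr)
    assume "\<not> u x > 0"
    have "connected (u ` S)"
      using assms by (intro connected_continuous_image)
    hence "0 \<in> u ` S"
      using \<open>\<not> u x > 0\<close> x assms by (auto intro: connectedD_interval [of _ "u x" "u a"])
    thus False
      using nz by auto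
  qed
qed auto

theorem theorem2p1:
  fixes \<beta> :: real and f :: "complex \<Rightarrow> complex"
  assumes "0 \<le> \<beta>" and "\<beta> \<le> 1" and "f \<in> class_A"
  shows "f \<in> class_A_beta \<beta> \<longleftrightarrow>
    (\<forall>z \<in> unit_disc - {0}. \<forall>\<zeta>::complex. norm \<zeta> = 1 \<and> \<zeta> \<noteq> 1 \<longrightarrow>
       hadamard_prod f
         (\<lambda>w. w * ((1 - of_real \<beta> * w) / (1 - w)\<^sup>2 - (1 + \<zeta>) / (1 - \<zeta>))) z \<noteq> 0)"
proof -
  define p where
    "p z = of_real \<beta> * (if z = 0 then 1 else f z / z) + of_real (1 - \<beta>) * deriv f z" for z
  have p0: "p 0 = 1"
    using assms(3) by (simp add: p_def class_A_def)
  have "continuous_on unit_disc (deriv f)"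
    using assms(3) by (auto simp: class_A_def unit_disc_def
        intro!: holomorphic_on_imp_continuous_on holomorphic_deriv)
  hence "continuous_on unit_disc (\<lambda>z. Re (p z))"
    unfolding p_def
    by (intro continuous_intros continuous_on_quotient_removed_singularity assms(3))
  hence pos_iff: "(\<forall>z\<in>unit_disc. Re (p z) > 0) \<longleftrightarrow> (\<forall>z\<in>unit_disc. Re (p z) \<noteq> 0)"
    by (intro connected_continuous_positive_iff_nonzero [where a = 0])
       (auto simp: p0 unit_disc_def)
  have "f \<in> class_A_beta \<beta> \<longleftrightarrow> (\<forall>z\<in>unit_disc. Re (p z) > 0)"
    using assms(3) by (simp add: class_A_beta_def p_def)
  \<comment> \<open>The origin can be left out because \<open>Re (p 0) = 1\<close>.\<close>
  also have "\<dots> \<longleftrightarrow> (\<forall>z\<in>unit_disc - {0}. Re (p z) \<noteq> 0)"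
    unfolding pos_iff using p0 by (metis DiffE DiffI one_complex.sel(1) singletonD zero_neq_one)
  also have "\<dots> \<longleftrightarrow> (\<forall>z\<in>unit_disc - {0}. \<forall>\<zeta>. norm \<zeta> = 1 \<and> \<zeta> \<noteq> 1 \<longrightarrow> p z \<noteq> (1 + \<zeta>) / (1 - \<zeta>))"
  proof -
    have "Re c \<noteq> 0 \<longleftrightarrow> (\<forall>\<zeta>. norm \<zeta> = 1 \<and> \<zeta> \<noteq> 1 \<longrightarrow> c \<noteq> (1 + \<zeta>) / (1 - \<zeta>))" for c
    proof -
      have "Re c = 0 \<longleftrightarrow> c \<in> (\<lambda>\<zeta>. (1 + \<zeta>) / (1 - \<zeta>)) ` {\<zeta>. norm \<zeta> = 1 \<and> \<zeta> \<noteq> 1}"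
        by (simp only: Cayley_transform_unit_circle mem_Collect_eq)
      thus ?thesis
        by blast
    qed
    thus ?thesis
      by blast
  qed
  also have "\<dots> \<longleftrightarrow> (\<forall>z \<in> unit_disc - {0}. \<forall>\<zeta>. norm \<zeta> = 1 \<and> \<zeta> \<noteq> 1 \<longrightarrow>
       hadamard_prod f
         (\<lambda>w. w * ((1 - of_real \<beta> * w) / (1 - w)\<^sup>2 - (1 + \<zeta>) / (1 - \<zeta>))) z \<noteq> 0)"
  proof -
    have "hadamard_prod f (\<lambda>w. w * ((1 - of_real \<beta> * w) / (1 - w)\<^sup>2 - c)) z = z * (p z - c)"
      if "z \<in> unit_disc - {0}" for z c
      using that by (subst hadamard_prod_kernel [OF assms(3)]) (auto simp: p_def algebra_simps)
    thus ?thesis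
      by simp
  qed
  finally show ?thesis .
qed

end
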